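(* There exist a Polish meta-abelian group $H$ and a subgroup $F\subset H$ such that $F$ is an $F_\sigma$-subset of $H$, $F$ is Haar null in $H$, and every $G_\delta$-set $G\subset H$ with $F\subset G$ is thick in $H$ and hence is not Haar null in $H$.
   Context: A Borel subset $B$ of a Polish group $H$ is called Haar null if there exists a $\sigma$-additive Borel probability measure $\mu$ on $H$ such that $\mu(xBy)=0$ for all $x,y\in H$, where $xBy=\{xby:b\in B\}$. A topological group $H$ is called meta-abelian if $H$ contains a closed normal abelian subgroup $A\subset H$ such that the quotient group $H/A$ is abelian. A subset $B$ of a topological group $H$ is called thick if for every compact subset $K\subset H$ there are points $x,y\in H$ such that $xKy\subset B$. *)

theory Defs
  imports "HOL-Probability.Probability" "HOL-Algebra.Algebra"
begin

text \<open>Topological groups are taken with an explicit carrier and an explicit topology on that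
  carrier, so that subgroups, quotients and existence of a group can be stated with HOL-Algebra.\<close>

locale topological_group = group H
  for H :: "('a, 'b) monoid_scheme" (structure) and T :: "'a topology" +
  assumes topspace_eq: "topspace T = carrier H"
    and continuous_mult: "continuous_map (prod_topology T T) T (\<lambda>(x, y). x \<otimes> y)"
    and continuous_inv: "continuous_map T T (\<lambda>x. inv x)"

text \<open>Every Polish space is homeomorphic to a subset of the type \<^typ>\<open>nat \<Rightarrow> real\<close> (with the
  product topology). So quantifying over Polish groups whose carrier is a subset of that type,
  with any topology on the carrier, covers all Polish groups up to topological isomorphism.\<close>

locale polish_group = topological_group +
  assumes completely_metrizable: "completely_metrizable_space T"
    and separable: "separable_space T"

definition meta_abelian :: "('a, 'b) monoid_scheme \<Rightarrow> 'a topology \<Rightarrow> bool" where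
  "meta_abelian H T \<longleftrightarrow> topological_group H T \<and>
     (\<exists>A. A \<lhd> H \<and> closedin T A \<and> comm_group (H\<lparr>carrier := A\<rparr>) \<and> comm_group (H Mod A))"

definition borel_of :: "'a topology \<Rightarrow> 'a measure" where
  "borel_of T = sigma (topspace T) {U. openin T U}"

definition translate :: "('a, 'b) monoid_scheme \<Rightarrow> 'a \<Rightarrow> 'a set \<Rightarrow> 'a \<Rightarrow> 'a set" where
  "translate H x B y = (\<lambda>b. x \<otimes>\<^bsub>H\<^esub> b \<otimes>\<^bsub>H\<^esub> y) ` B"

text \<open>Being Borel is part of being Haar null. In a topological group two-sided translates of Borel
  sets are Borel, so \<open>emeasure\<close> is never evaluated below at a non-measurable set.\<close>

definition haar_null :: "('a, 'b) monoid_scheme \<Rightarrow> 'a topology \<Rightarrow> 'a set \<Rightarrow> bool" where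
  "haar_null H T B \<longleftrightarrow> B \<in> sets (borel_of T) \<and>
     (\<exists>\<mu>. prob_space \<mu> \<and> sets \<mu> = sets (borel_of T) \<and>
        (\<forall>x\<in>carrier H. \<forall>y\<in>carrier H. emeasure \<mu> (translate H x B y) = 0))"

definition thick :: "('a, 'b) monoid_scheme \<Rightarrow> 'a topology \<Rightarrow> 'a set \<Rightarrow> bool" where
  "thick H T B \<longleftrightarrow> B \<subseteq> carrier H \<and>
     (\<forall>K. compactin T K \<longrightarrow> (\<exists>x\<in>carrier H. \<exists>y\<in>carrier H. translate H x K y \<subseteq> B))"

text \<open>Hence a \<open>G\<^sub>\<delta>\<close>-set that is not Haar null fails the measure condition, not the Borel condition.\<close>

lemma gdelta_in_borel_of:
  assumes "gdelta_in T G"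
  shows "G \<in> sets (borel_of T)"
proof -
  obtain \<U> where U: "countable \<U>" "\<U> \<subseteq> {U. openin T U}" "G = topspace T \<inter> \<Inter>\<U>"
    using assms unfolding gdelta_in_def relative_to_def intersection_of_def by blast
  have op: "U \<in> sets (borel_of T)" if "openin T U" for U
    using that openin_subset[of T] unfolding borel_of_def by (intro in_measure_of) auto
  show ?thesis
  proof (cases "\<U> = {}")
    case True
    then show ?thesis using U(3) op[of "topspace T"] by simp
  next
    case False
    then have "\<Inter>\<U> \<in> sets (borel_of T)"
      using sets.countable_INT'[of \<U> "\<lambda>U. U"] U(1,2) op by auto
    then show ?thesis using U(3) op[of "topspace T"] by auto
  qed
qed

end

theory Submission
  imports Defs
begin

text \<open>The group \<open>H\<close> is the countable power of the group of increasing affine maps of the line,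
  \<open>v \<mapsto> a + s v\<close> with \<open>s > 0\<close>, and \<open>F\<close> consists of the sequences of affine maps all but
  finitely many of which have translation part \<open>a = 0\<close>, the scalings being arbitrary.

  \<open>F\<close> is Haar null because the scalings do not help it inside the normal subgroup \<open>A\<close> of pure
  translations: a two-sided translate of \<open>F\<close> meets \<open>A\<close> in sequences whose tail is
  prescribed, so it meets the line of constant sequences \<open>(t, t, t, \<dots>)\<close> in at most one point. The
  uniform measure on a segment of that line is a test measure (\<open>haar_null_fin_transl\<close>).

  A \<open>G\<^sub>\<delta>\<close>-set \<open>G \<supseteq> F\<close> is thick because conjugation by a sequence of scalings fixes all
  scaling parts and multiplies the translation parts by factors that can be chosen freely. It
  therefore suffices that \<open>G\<close> contain a compact cube which has arbitrary prescribed sides in the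
  scaling coordinates and some positive side in each translation coordinate
  (\<open>gdelta_contains_cube\<close>). Write \<open>G\<close> as the intersection of open sets \<open>U k\<close>. A cube with only
  finitely many nonzero translation sides lies in \<open>F\<close>, hence in \<open>U k\<close>, and by compactness some
  room remains (\<open>cube_enlarge\<close>): further translation sides can be made positive, and the
  ones beyond them may still grow up to \<open>1\<close> without leaving \<open>U k\<close>. Doing this for
  \<open>k = 0, 1, 2, \<dots>\<close> yields the cube.

  Finally, a thick set is not Haar null, because every Borel probability measure on a Polish
  space charges some compact set (\<open>thick_imp_not_haar_null\<close>).\<close>

section \<open>The group of sequences of affine maps\<close>

text \<open>For even \<open>n\<close>, the coordinates \<open>n\<close> and \<open>n + 1\<close> of \<open>x\<close> encode the affine map
  \<open>v \<mapsto> x n + exp (x (n + 1)) * v\<close>. With logarithms of scalings as coordinates, the carrier is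
  all of \<open>nat \<Rightarrow> real\<close> and the group topology is its product topology.\<close>

definition aff_mult :: "(nat \<Rightarrow> real) \<Rightarrow> (nat \<Rightarrow> real) \<Rightarrow> nat \<Rightarrow> real" where
  "aff_mult x y n = (if even n then x n + exp (x (Suc n)) * y n else x n + y n)"

definition aff_inv :: "(nat \<Rightarrow> real) \<Rightarrow> nat \<Rightarrow> real" where
  "aff_inv x n = (if even n then - (exp (- x (Suc n)) * x n) else - x n)"

definition aff_group :: "(nat \<Rightarrow> real) monoid" where
  "aff_group = \<lparr>carrier = UNIV, monoid.mult = aff_mult, one = (\<lambda>_. 0)\<rparr>"

lemma aff_group_simps [simp]:
  "carrier aff_group = UNIV"
  "x \<otimes>\<^bsub>aff_group\<^esub> y = aff_mult x y"
  "\<one>\<^bsub>aff_group\<^esub> = (\<lambda>_. 0)"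
  by (simp_all add: aff_group_def)

lemma aff_inv_left: "aff_mult (aff_inv x) x = (\<lambda>_. 0)"
  by (auto simp: aff_mult_def aff_inv_def fun_eq_iff)

lemma group_aff_group: "group aff_group"
proof (rule groupI)
  fix x y z
  show "x \<otimes>\<^bsub>aff_group\<^esub> y \<otimes>\<^bsub>aff_group\<^esub> z = x \<otimes>\<^bsub>aff_group\<^esub> (y \<otimes>\<^bsub>aff_group\<^esub> z)"
    by (auto simp: aff_mult_def fun_eq_iff algebra_simps exp_add)
  show "\<exists>y\<in>carrier aff_group. y \<otimes>\<^bsub>aff_group\<^esub> x = \<one>\<^bsub>aff_group\<^esub>"
    using aff_inv_left by (intro bexI[of _ "aff_inv x"]) auto
qed (auto simp: aff_mult_def)

lemma inv_aff_group: "inv\<^bsub>aff_group\<^esub> x = aff_inv x"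
  using group.inv_equality[OF group_aff_group, of "aff_inv x" x] aff_inv_left by simp

lemma topological_group_aff_group: "topological_group aff_group euclidean"
proof (intro topological_group.intro topological_group_axioms.intro group_aff_group)
  have coord: "continuous_on UNIV (\<lambda>p :: (nat \<Rightarrow> real) \<times> (nat \<Rightarrow> real). fst p n)"
    "continuous_on UNIV (\<lambda>p :: (nat \<Rightarrow> real) \<times> (nat \<Rightarrow> real). snd p n)" for n
    by (fact continuous_on_product_then_coordinatewise[OF continuous_on_fst[OF continuous_on_id]]
        continuous_on_product_then_coordinatewise[OF continuous_on_snd[OF continuous_on_id]])+
  have "continuous_on UNIV (\<lambda>p. aff_mult (fst p) (snd p))"
  proof (rule continuous_on_coordinatewise_then_product)
    show "continuous_on UNIV (\<lambda>p. aff_mult (fst p) (snd p) n)" for n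
      unfolding aff_mult_def by (cases "even n")
        (simp_all add: continuous_on_add continuous_on_mult continuous_on_exp coord)
  qed
  then show "continuous_map (prod_topology euclidean euclidean) euclidean
      (\<lambda>(x, y). x \<otimes>\<^bsub>aff_group\<^esub> y)"
    by (simp add: split_beta)
  have "continuous_on UNIV aff_inv"
  proof (rule continuous_on_coordinatewise_then_product)
    show "continuous_on UNIV (\<lambda>x. aff_inv x n)" for n
      unfolding aff_inv_def by (cases "even n")
        (simp_all add: continuous_on_minus continuous_on_mult continuous_on_exp)
  qed
  then show "continuous_map euclidean euclidean (\<lambda>x. inv\<^bsub>aff_group\<^esub> x)"
    by (simp add: inv_aff_group)
qed simp

lemma separable_space_euclidean:
  "separable_space (euclidean :: 'a::second_countable_topology topology)"
proof -
  have "\<exists>D. countable (D :: 'a set) \<and> (\<forall>U. open U \<longrightarrow> U \<noteq> {} \<longrightarrow> (\<exists>d \<in> D. d \<in> U))"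
    by (rule countable_dense_exists)
  then obtain D :: "'a set" where D: "countable D" "\<forall>U. open U \<longrightarrow> U \<noteq> {} \<longrightarrow> (\<exists>d \<in> D. d \<in> U)"
    by (elim exE conjE)
  have "x \<in> closure D" for x
    unfolding closure_iff_nhds_not_empty by (metis D(2) disjoint_iff empty_iff subsetD)
  with D(1) show ?thesis
    unfolding separable_space_def by (intro exI[of _ D]) auto
qed

lemma polish_group_aff_group: "polish_group aff_group euclidean"
  by (intro polish_group.intro polish_group_axioms.intro topological_group_aff_group
      completely_metrizable_space_euclidean separable_space_euclidean)

text \<open>The cosets of \<open>xy\<close> and \<open>yx\<close> agree as soon as their quotient lies in the subgroup.\<close>

lemma (in group) comm_group_Mod_if_commutators:
  assumes N: "N \<lhd> G"
    and comm: "\<And>x y. x \<in> carrier G \<Longrightarrow> y \<in> carrier G \<Longrightarrow> (x \<otimes> y) \<otimes> inv (y \<otimes> x) \<in> N"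
  shows "comm_group (G Mod N)"
proof -
  interpret normal N G by (rule N)
  have "N #> (x \<otimes> y) = N #> (y \<otimes> x)" if "x \<in> carrier G" "y \<in> carrier G" for x y
  proof (rule repr_independence[OF _ _ is_subgroup, symmetric])
    show "x \<otimes> y \<in> N #> (y \<otimes> x)"
      using that comm[OF that] unfolding r_coset_def
      by (auto intro!: bexI[of _ "(x \<otimes> y) \<otimes> inv (y \<otimes> x)"] simp: m_assoc)
  qed (use that in auto)
  then show ?thesis
    by (intro group.group_comm_groupI factorgroup_is_group)
      (auto simp: carrier_FactGroup rcos_sum)
qed

lemma meta_abelian_aff_group: "meta_abelian aff_group euclidean"
proof -
  interpret group aff_group by (rule group_aff_group)
  \<comment> \<open>the translations: the kernel of the homomorphism to the abelian group of scalings\<close>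
  define A where "A = {x :: nat \<Rightarrow> real. \<forall>n. odd n \<longrightarrow> x n = 0}"
  have normal: "A \<lhd> aff_group"
    unfolding normal_inv_iff
  proof (intro conjI ballI)
    show "subgroup A aff_group"
      by (rule subgroupI) (auto simp: A_def aff_mult_def inv_aff_group aff_inv_def)
  qed (auto simp: A_def aff_mult_def inv_aff_group aff_inv_def)
  have "A = (\<Inter>n\<in>{n. odd n}. {x. x n = 0})"
    by (auto simp: A_def)
  moreover have "closed {x :: nat \<Rightarrow> real. x n = 0}" for n
    by (intro closed_Collect_eq) auto
  ultimately have closed: "closed A"
    by auto
  have "group (aff_group\<lparr>carrier := A\<rparr>)"
    using normal normal_imp_subgroup subgroup_imp_group by blast
  then have abelian: "comm_group (aff_group\<lparr>carrier := A\<rparr>)"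
    by (rule group.group_comm_groupI) (auto simp: A_def aff_mult_def fun_eq_iff)
  have "comm_group (aff_group Mod A)"
    by (rule comm_group_Mod_if_commutators[OF normal])
      (auto simp: A_def aff_mult_def inv_aff_group aff_inv_def)
  with normal closed abelian show ?thesis
    unfolding meta_abelian_def using topological_group_aff_group by auto
qed

section \<open>The subgroup of sequences with finitely many translations\<close>

definition fin_transl :: "(nat \<Rightarrow> real) set" where
  "fin_transl = {x. \<exists>N. \<forall>n\<ge>N. even n \<longrightarrow> x n = 0}"

lemma subgroup_fin_transl: "subgroup fin_transl aff_group"
proof (rule group.subgroupI[OF group_aff_group])
  show "fin_transl \<noteq> {}"
    by (auto simp: fin_transl_def intro!: exI[of _ "\<lambda>_. 0"])
  fix x y assume "x \<in> fin_transl" "y \<in> fin_transl"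
  then obtain M N where "\<forall>n\<ge>M. even n \<longrightarrow> x n = 0" "\<forall>n\<ge>N. even n \<longrightarrow> y n = 0"
    by (auto simp: fin_transl_def)
  then have "\<forall>n\<ge>max M N. even n \<longrightarrow> aff_mult x y n = 0"
    by (auto simp: aff_mult_def)
  then show "x \<otimes>\<^bsub>aff_group\<^esub> y \<in> fin_transl"
    unfolding fin_transl_def aff_group_simps by blast
qed (auto simp: fin_transl_def inv_aff_group aff_inv_def)

lemma fsigma_fin_transl: "fsigma_in euclidean fin_transl"
proof -
  define C :: "nat \<Rightarrow> (nat \<Rightarrow> real) set" where "C N = {x. \<forall>n\<ge>N. even n \<longrightarrow> x n = 0}" for N
  have "C N = (\<Inter>n\<in>{n. n \<ge> N \<and> even n}. {x. x n = 0})" for N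
    by (auto simp: C_def)
  moreover have "closed {x :: nat \<Rightarrow> real. x n = 0}" for n
    by (intro closed_Collect_eq) auto
  ultimately have "closed (C N)" for N
    by auto
  moreover have "fin_transl = (\<Union>N. C N)"
    by (auto simp: fin_transl_def C_def)
  moreover have "C N \<subseteq> C (Suc N)" for N
    by (auto simp: C_def)
  ultimately show ?thesis
    unfolding fsigma_in_ascending by (intro exI[of _ C]) auto
qed

lemma borel_of_euclidean: "borel_of euclidean = borel"
  by (simp add: borel_of_def borel_def)

text \<open>The test measure is uniform on a segment of the line of constant sequences of translations.
  If the constant translation by \<open>t\<close> equals \<open>x f y\<close> with \<open>f\<close> in the subgroup, then \<open>t\<close> can be
  read off from \<open>x\<close> and \<open>y\<close> at any coordinate where \<open>f\<close> has no translation part.\<close>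

lemma haar_null_fin_transl: "haar_null aff_group euclidean fin_transl"
proof -
  define line :: "real \<Rightarrow> nat \<Rightarrow> real" where "line t n = (if even n then t else 0)" for t n
  define unif where "unif = uniform_measure lborel {0..1::real}"
  define \<mu> where "\<mu> = distr unif borel line"
  have "continuous_on UNIV line"
  proof (rule continuous_on_coordinatewise_then_product)
    show "continuous_on UNIV (\<lambda>t. line t n)" for n
      unfolding line_def by (cases "even n") (auto intro!: continuous_intros)
  qed
  then have "line \<in> borel_measurable borel"
    by (rule borel_measurable_continuous_onI)
  then have line: "line \<in> borel_measurable unif"
    unfolding unif_def by (simp cong: measurable_cong_sets)
  have "prob_space unif"
    unfolding unif_def by (rule prob_space_uniform_measure) auto
  then have prob: "prob_space \<mu>"
    unfolding \<mu>_def by (rule prob_space.prob_space_distr) (rule line)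
  have null: "emeasure \<mu> (translate aff_group x fin_transl y) = 0" (is "emeasure \<mu> ?S = 0")
    for x y
  proof (cases "?S \<in> sets borel")
    case False
    then show ?thesis by (simp add: \<mu>_def emeasure_notin_sets)
  next
    case True
    have eventually_const: "\<exists>N. \<forall>n\<ge>N. even n \<longrightarrow> t = x n + exp (- y (Suc n)) * y n"
      if "line t \<in> ?S" for t
    proof -
      from that obtain f N where f: "line t = aff_mult (aff_mult x f) y"
        and N: "\<forall>n\<ge>N. even n \<longrightarrow> f n = 0"
        by (auto simp: translate_def fin_transl_def)
      have "t = x n + exp (- y (Suc n)) * y n" if "n \<ge> N" "even n" for n
      proof -
        \<comment> \<open>The line has trivial scalings, which determines the scaling of \<open>f\<close> from those of
          \<open>x\<close> and \<open>y\<close>.\<close>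
        have "x (Suc n) + f (Suc n) = - y (Suc n)"
          using fun_cong[OF f, of "Suc n"] that by (simp add: line_def aff_mult_def)
        then show ?thesis
          using fun_cong[OF f, of n] that N by (simp add: line_def aff_mult_def)
      qed
      then show ?thesis by blast
    qed
    have "t = t'" if "line t \<in> ?S" "line t' \<in> ?S" for t t'
    proof -
      from that[THEN eventually_const] obtain N N' where
        N: "\<forall>n\<ge>N. even n \<longrightarrow> t = x n + exp (- y (Suc n)) * y n" and
        N': "\<forall>n\<ge>N'. even n \<longrightarrow> t' = x n + exp (- y (Suc n)) * y n"
        by blast
      show ?thesis
        using N[rule_format, of "2 * (N + N')"] N'[rule_format, of "2 * (N + N')"] by simp
    qed
    then obtain t where "line -` ?S \<subseteq> {t}"
      by blast
    then have countable: "countable (line -` ?S)"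
      by (rule countable_subset) simp
    then have "emeasure lborel ({0..1} \<inter> line -` ?S) = 0"
      by (intro emeasure_lborel_countable countable_Int2)
    moreover have "line -` ?S \<in> sets lborel"
      using measurable_sets[OF line, of ?S] True by (simp add: unif_def)
    ultimately have "emeasure unif (line -` ?S) = 0"
      by (simp add: unif_def)
    then show ?thesis
      using True line by (simp add: \<mu>_def emeasure_distr unif_def)
  qed
  have "fin_transl \<in> sets (borel_of euclidean)"
  proof -
    have "gdelta_in euclidean (- fin_transl)"
      using fsigma_fin_transl by (simp add: fsigma_in_gdelta_in Compl_eq_Diff_UNIV)
    from gdelta_in_borel_of[OF this] show ?thesis
      using sets.compl_sets[of "- fin_transl" "borel :: (nat \<Rightarrow> real) measure"]
      by (simp add: borel_of_euclidean Diff_eq)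
  qed
  with prob null show ?thesis
    unfolding haar_null_def by (intro conjI exI[of _ \<mu>]) (auto simp: borel_of_euclidean \<mu>_def)
qed

section \<open>Cubes inside a neighbourhood of the subgroup\<close>

definition cube :: "(nat \<Rightarrow> real) \<Rightarrow> (nat \<Rightarrow> real) set" where
  "cube r = {x. \<forall>n. \<bar>x n\<bar> \<le> r n}"

lemma cube_mono: "(\<And>n. r n \<le> s n) \<Longrightarrow> cube r \<subseteq> cube s"
  unfolding cube_def by (auto intro: order_trans)

lemma compact_cube: "compact (cube r)"
proof -
  have "cube r = PiE UNIV (\<lambda>n. {- r n..r n})"
    by (auto simp: cube_def PiE_iff abs_le_iff minus_le_iff)
  then have "compactin (product_topology (\<lambda>_. euclidean) UNIV) (cube r)"
    by (simp add: compactin_PiE)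
  then show ?thesis
    by (simp add: euclidean_product_topology)
qed

lemma compact_subset_cube:
  assumes "compact (K :: (nat \<Rightarrow> real) set)"
  obtains M where "\<And>n. M n > 0" "K \<subseteq> cube M"
proof -
  have "\<exists>b>0. \<forall>x\<in>K. \<bar>x n\<bar> \<le> b" for n
  proof -
    have "compact ((\<lambda>x. x n) ` K)"
      by (intro compact_continuous_image assms continuous_on_subset[OF continuous_on_product_coordinates]) auto
    then show ?thesis
      by (auto dest!: compact_imp_bounded simp: bounded_pos)
  qed
  then obtain M where "\<And>n. M n > 0 \<and> (\<forall>x\<in>K. \<bar>x n\<bar> \<le> M n)"
    by metis
  then show ?thesis
    by (intro that[of M]) (auto simp: cube_def)
qed

text \<open>In the product topology a neighbourhood constrains only finitely many coordinates. Hence, by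
  compactness, finitely many sides of a cube inside an open set can be lengthened by some positive
  amount and all the others by \<open>1\<close>: such enlargements form a decreasing sequence of compact cubes
  whose intersection is the given cube.\<close>

lemma cube_enlarge:
  assumes "open U" "cube r \<subseteq> U"
  obtains m e where "0 < e" "e \<le> 1" "cube (\<lambda>n. r n + (if n < m then e else 1)) \<subseteq> U"
proof -
  define rad where "rad k n = r n + (if n < k then 1 / real (Suc k) else 1)" for k n :: nat
  have anti: "cube (rad l) \<subseteq> cube (rad k)" if "k \<le> l" for k l
    using that by (intro cube_mono) (auto simp: rad_def field_simps)
  have "x \<in> cube r" if x: "\<And>k. x \<in> cube (rad k)" for x
    unfolding cube_def
  proof (intro CollectI allI)
    fix n
    have "\<bar>x n\<bar> \<le> r n + e" if "e > 0" for e
    proof -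
      obtain j where j: "1 / real (Suc j) < e"
        using nat_approx_posE[OF \<open>e > 0\<close>] by blast
      define k where "k = max j (Suc n)"
      have "\<bar>x n\<bar> \<le> r n + 1 / real (Suc k)"
        using x[of k] by (auto simp: cube_def rad_def k_def split: if_splits dest!: spec[of _ n])
      also have "1 / real (Suc k) \<le> 1 / real (Suc j)"
        by (intro divide_left_mono) (auto simp: k_def)
      finally show ?thesis using j by simp
    qed
    then show "\<bar>x n\<bar> \<le> r n"
      by (rule field_le_epsilon)
  qed
  then have cover: "cube (rad 0) - U \<subseteq> (\<Union>k. - cube (rad k))"
    using assms(2) by blast
  have "compact (cube (rad 0) - U)"
    by (intro compact_diff compact_cube assms)
  then obtain I where I: "finite I" "cube (rad 0) - U \<subseteq> (\<Union>k\<in>I. - cube (rad k))"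
    by (rule compactE_image[where C = UNIV and f = "\<lambda>k. - cube (rad k)"])
      (use cover in \<open>auto intro: compact_imp_closed compact_cube\<close>)
  define m where "m = Max (insert 0 I)"
  have "cube (rad m) \<subseteq> cube (rad k)" if "k \<in> insert 0 I" for k
    using I(1) that by (intro anti) (auto simp: m_def)
  then have "cube (rad m) \<subseteq> U"
    using I(2) by blast
  then show ?thesis
    by (intro that[of "1 / real (Suc m)" m]) (auto simp: rad_def[abs_def])
qed

text \<open>The subgroup
  contains every cube with finitely many nonzero even sides, so the even sides of the desired cube
  can be made positive in successive finite blocks, the \<open>k\<close>-th block taking care of \<open>U k\<close>.\<close>

lemma gdelta_contains_cube:
  fixes U :: "nat \<Rightarrow> (nat \<Rightarrow> real) set"
  assumes U: "\<And>k. open (U k)" "\<And>k. fin_transl \<subseteq> U k" and M: "\<And>n. M n \<ge> 0"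
  obtains r where "\<forall>n. even n \<longrightarrow> r n > 0" "\<forall>n. odd n \<longrightarrow> r n = M n" "cube r \<subseteq> (\<Inter>k. U k)"
proof -
  \<comment> \<open>A state is a pair \<open>(m, r)\<close>: the sides of the cube \<open>r\<close> below \<open>m\<close> are final, and its even sides
    from \<open>m\<close> on are still \<open>0\<close>. The bound \<open>k \<le> m\<close> makes every side final eventually; the bound
    \<open>1\<close> on the even sides keeps all later states within the room that \<open>Q\<close> reserves.\<close>
  define P :: "nat \<Rightarrow> nat \<times> (nat \<Rightarrow> real) \<Rightarrow> bool" where
    "P k p \<longleftrightarrow> k \<le> fst p \<and> (\<forall>n. odd n \<longrightarrow> snd p n = M n) \<and>
      (\<forall>n. even n \<longrightarrow> n < fst p \<longrightarrow> 0 < snd p n \<and> snd p n \<le> 1) \<and>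
      (\<forall>n. even n \<longrightarrow> fst p \<le> n \<longrightarrow> snd p n = 0)" for k p
  define Q :: "nat \<Rightarrow> nat \<times> (nat \<Rightarrow> real) \<Rightarrow> nat \<times> (nat \<Rightarrow> real) \<Rightarrow> bool" where
    "Q k p q \<longleftrightarrow> fst p \<le> fst q \<and> (\<forall>n<fst p. snd q n = snd p n) \<and>
      cube (\<lambda>n. snd q n + (if n < fst q then 0 else 1)) \<subseteq> U k" for k p q
  have "\<exists>p. \<forall>k. P k (p k) \<and> Q k (p k) (p (Suc k))"
  proof (rule dependent_nat_choice)
    show "\<exists>p. P 0 p"
      by (intro exI[of _ "(0, \<lambda>n. if odd n then M n else 0)"]) (auto simp: P_def)
  next
    fix p k assume P: "P k p"
    obtain m r where p: "p = (m, r)"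
      by (cases p)
    have "cube r \<subseteq> fin_transl"
      unfolding cube_def fin_transl_def
    proof (intro subsetI CollectI exI[of _ m] allI impI)
      fix x n assume "x \<in> {x. \<forall>n. \<bar>x n\<bar> \<le> r n}" "m \<le> n" "even n"
      moreover from this have "r n = 0"
        using P by (simp add: p P_def)
      ultimately show "x n = 0"
        by (metis abs_le_zero_iff mem_Collect_eq)
    qed
    then have "cube r \<subseteq> U k"
      using U(2) by (rule order_trans)
    then obtain m0 e where e: "0 < e" "e \<le> 1"
      and sub: "cube (\<lambda>n. r n + (if n < m0 then e else 1)) \<subseteq> U k"
      by (rule cube_enlarge[OF U(1)])
    define m' where "m' = max m0 (Suc m)"
    define r' where "r' n = (if even n \<and> m \<le> n \<and> n < m' then e else r n)" for n
    have "r' n + (if n < m' then 0 else 1) \<le> r n + (if n < m0 then e else 1)" for n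
      using P e by (auto simp: p P_def r'_def m'_def)
    from cube_mono[of _ "\<lambda>n. r n + (if n < m0 then e else 1)", OF this] sub
    have "cube (\<lambda>n. r' n + (if n < m' then 0 else 1)) \<subseteq> U k"
      by (rule order_trans)
    moreover have "P (Suc k) (m', r')"
      using P e by (auto simp: p P_def r'_def m'_def)
    ultimately show "\<exists>q. P (Suc k) q \<and> Q k p q"
      by (intro exI[of _ "(m', r')"]) (auto simp: p Q_def r'_def m'_def)
  qed
  then obtain p where P: "\<And>k. P k (p k)" and Q: "\<And>k. Q k (p k) (p (Suc k))"
    by blast
  define m where "m k = fst (p k)" for k
  \<comment> \<open>side \<open>n\<close> is final in state \<open>n + 1\<close>, as \<open>n < n + 1 \<le> m (n + 1)\<close>\<close>
  define r where "r n = snd (p (Suc n)) n" for n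
  have m_ge: "k \<le> m k" for k
    using P by (simp add: P_def m_def)
  have mono_m: "m k \<le> m l" if "k \<le> l" for k l
    using Q by (intro lift_Suc_mono_le[OF _ that]) (simp add: Q_def m_def)
  have stable: "snd (p l) n = snd (p k) n" if "k \<le> l" "n < m k" for k l n
    using that
  proof (induction l rule: dec_induct)
    case (step l)
    then have "n < m l"
      using mono_m[of k l] by simp
    then show ?case
      using step Q[of l] by (simp add: Q_def m_def)
  qed simp
  have r_eq: "r n = snd (p k) n" if "n < m k" for n k
    using stable[of k "Suc n" n] stable[of "Suc n" k n] that m_ge[of "Suc n"]
    unfolding r_def by (cases "k \<le> Suc n") auto
  have odd: "r n = M n" if "odd n" for n
    using P[of "Suc n"] that by (simp add: r_def P_def)
  have even: "0 < r n" "r n \<le> 1" if "even n" for n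
    using P[of "Suc n"] that by (auto simp: r_def P_def)
  have "cube r \<subseteq> U k" for k
  proof -
    have "r n \<le> snd (p (Suc k)) n + (if n < m (Suc k) then 0 else 1)" for n
      using r_eq[of n "Suc k"] odd[of n] even[of n] P[of "Suc k"]
      by (cases "even n") (auto simp: P_def m_def)
    then have "cube r \<subseteq> cube (\<lambda>n. snd (p (Suc k)) n + (if n < m (Suc k) then 0 else 1))"
      by (rule cube_mono)
    then show ?thesis
      using Q[of k] unfolding Q_def m_def by blast
  qed
  with odd even(1) show ?thesis
    by (intro that[of r]) auto
qed

section \<open>Thickness\<close>

text \<open>Conjugation by the scalings \<open>exp (x (n + 1)) = r n / M n\<close> maps the cube \<open>M\<close>, chosen to
  contain the given compact set, into the cube \<open>r\<close> inside \<open>G\<close>. The scaling coordinates are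
  unchanged by it, which is why \<open>r\<close> has to agree with \<open>M\<close> at odd coordinates.\<close>

lemma thick_if_gdelta_superset:
  assumes "gdelta_in euclidean G" "fin_transl \<subseteq> G"
  shows "thick aff_group euclidean G"
  unfolding thick_def
proof (intro conjI allI impI)
  fix K :: "(nat \<Rightarrow> real) set" assume "compactin euclidean K"
  then obtain M where M: "\<And>n. M n > 0" "K \<subseteq> cube M"
    using compact_subset_cube by auto
  from assms(1) obtain U where "\<forall>k. open (U k)" "\<forall>k. U (Suc k) \<subseteq> U k" "(\<Inter>k. U k) = G"
    unfolding gdelta_in_descending open_openin[symmetric] by (elim exE conjE)
  then have U: "open (U k)" "(\<Inter>k. U k) = G" for k
    by auto
  have sub: "fin_transl \<subseteq> U k" for k
    using assms(2) U(2) by blast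
  obtain r where r': "\<forall>n. even n \<longrightarrow> r n > 0" "\<forall>n. odd n \<longrightarrow> r n = M n" "cube r \<subseteq> G"
    by (rule gdelta_contains_cube[of U M, OF U(1) sub less_imp_le[OF M(1)], unfolded U(2)])
  then have r: "\<And>n. even n \<Longrightarrow> r n > 0" "\<And>n. odd n \<Longrightarrow> r n = M n"
    by auto
  define x where "x n = (if even n then 0 else ln (r (n - 1) / M (n - 1)))" for n
  have "aff_mult (aff_mult x h) (\<lambda>n. - x n) \<in> cube r" if "h \<in> cube M" for h
    unfolding cube_def
  proof (intro CollectI allI)
    fix n
    have h: "\<bar>h n\<bar> \<le> M n"
      using that by (simp add: cube_def)
    show "\<bar>aff_mult (aff_mult x h) (\<lambda>n. - x n) n\<bar> \<le> r n"
    proof (cases "even n")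
      case True
      then have "aff_mult (aff_mult x h) (\<lambda>n. - x n) n = r n / M n * h n"
        using r(1)[of n] M(1)[of n] by (simp add: aff_mult_def x_def)
      also have "\<bar>\<dots>\<bar> \<le> r n / M n * M n"
        unfolding abs_mult using h r(1)[OF True] M(1)[of n] by (intro mult_mono) auto
      finally show ?thesis
        using M(1)[of n] by simp
    next
      case False
      then show ?thesis
        using h r(2) by (simp add: aff_mult_def)
    qed
  qed
  then have "translate aff_group x K (\<lambda>n. - x n) \<subseteq> G"
    using M(2) r'(3) by (auto simp: translate_def)
  then show "\<exists>x\<in>carrier aff_group. \<exists>y\<in>carrier aff_group. translate aff_group x K y \<subseteq> G"
    by auto
qed simp

text \<open>If \<open>x K y \<subseteq> G\<close>, then \<open>K\<close> lies in a two-sided translate of \<open>G\<close>, so a measure witnessing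
  that \<open>G\<close> is Haar null would vanish on every compact \<open>K\<close>; inner regularity forbids this.\<close>

lemma thick_imp_not_haar_null:
  fixes H :: "('a::polish_space, 'b) monoid_scheme"
  assumes "topological_group H euclidean" "thick H euclidean G"
  shows "\<not> haar_null H euclidean G"
proof
  interpret topological_group H euclidean by (rule assms(1))
  have carrier: "carrier H = UNIV"
    using topspace_eq by simp
  assume "haar_null H euclidean G"
  then obtain \<mu> where G: "G \<in> sets borel" and "prob_space \<mu>" and \<mu>: "sets \<mu> = sets borel"
    and null: "\<And>x y. emeasure \<mu> (translate H x G y) = 0"
    unfolding haar_null_def borel_of_euclidean carrier by blast
  interpret prob_space \<mu> by fact
  have "emeasure \<mu> K = 0" if K: "compact K" for K
  proof -
    obtain x y where xy: "translate H x K y \<subseteq> G"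
      using assms(2) K unfolding thick_def by auto
    define f where "f h = x \<otimes>\<^bsub>H\<^esub> h \<otimes>\<^bsub>H\<^esub> y" for h
    have "continuous_on UNIV (\<lambda>p. fst p \<otimes>\<^bsub>H\<^esub> snd p)"
      using continuous_mult by (simp add: split_beta)
    then have mult: "continuous_on UNIV (\<lambda>h. g h \<otimes>\<^bsub>H\<^esub> g' h)"
      if "continuous_on UNIV g" "continuous_on UNIV g'" for g g' :: "'a \<Rightarrow> 'a"
      using continuous_on_compose2[OF _ continuous_on_Pair[OF that], of UNIV "\<lambda>p. fst p \<otimes>\<^bsub>H\<^esub> snd p"]
      by simp
    have "continuous_on UNIV f"
      unfolding f_def by (intro mult continuous_intros)
    then have "f -` G \<in> sets \<mu>"
      using measurable_sets[OF borel_measurable_continuous_onI G] \<mu> by simp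
    \<comment> \<open>Writing the translate as a preimage under a continuous map shows that it is Borel, which the
      monotonicity of the measure requires.\<close>
    moreover have "f -` G = translate H (inv\<^bsub>H\<^esub> x) G (inv\<^bsub>H\<^esub> y)"
    proof -
      have cancel: "inv\<^bsub>H\<^esub> g \<otimes>\<^bsub>H\<^esub> (g \<otimes>\<^bsub>H\<^esub> h) = h"
        "g \<otimes>\<^bsub>H\<^esub> (inv\<^bsub>H\<^esub> g \<otimes>\<^bsub>H\<^esub> h) = h" for g h
        by (simp_all add: carrier flip: m_assoc)
      have "inv\<^bsub>H\<^esub> x \<otimes>\<^bsub>H\<^esub> f h \<otimes>\<^bsub>H\<^esub> inv\<^bsub>H\<^esub> y = h"
        "f (inv\<^bsub>H\<^esub> x \<otimes>\<^bsub>H\<^esub> h \<otimes>\<^bsub>H\<^esub> inv\<^bsub>H\<^esub> y) = h" for h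
        by (simp_all add: f_def carrier m_assoc cancel)
      then show ?thesis
        unfolding translate_def by (auto simp: image_iff) metis
    qed
    moreover have "K \<subseteq> f -` G"
      using xy by (auto simp: translate_def f_def)
    ultimately show ?thesis
      using null emeasure_mono[of K "f -` G" \<mu>] by simp
  qed
  then have "emeasure \<mu> UNIV = 0"
    by (subst inner_regular[OF \<mu>]) (auto intro!: SUP_eqI)
  moreover have "space \<mu> = UNIV"
    using sets_eq_imp_space_eq[OF \<mu>] by simp
  ultimately show False
    using emeasure_space_1 by simp
qed

theorem theorem1:
  shows "\<exists>(H :: (nat \<Rightarrow> real) monoid) (T :: (nat \<Rightarrow> real) topology) F.
    polish_group H T \<and> meta_abelian H T \<and>
    subgroup F H \<and> fsigma_in T F \<and> haar_null H T F \<and>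
    (\<forall>G. gdelta_in T G \<and> F \<subseteq> G \<longrightarrow> thick H T G \<and> \<not> haar_null H T G)"
proof (intro exI conjI allI impI)
  fix G assume "gdelta_in euclidean G \<and> fin_transl \<subseteq> G"
  then show "thick aff_group euclidean G"
    using thick_if_gdelta_superset by simp
  then show "\<not> haar_null aff_group euclidean G"
    by (rule thick_imp_not_haar_null[OF topological_group_aff_group])
qed (rule polish_group_aff_group meta_abelian_aff_group subgroup_fin_transl fsigma_fin_transl
    haar_null_fin_transl)+

end
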